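(* Let $G$ be a graph of order $n\ge 1$. Then $\dim_2(G)=2$ if and only if one of the following holds: (1) $n=3$ and $G$ is $K_3$ or $\overline{K}_3$; (2) $n=4$ and $G$ is neither $K_4$ nor $\overline{K}_4$; (3) $n=5$ and neither $G$ nor $\overline{G}$ is any of the graphs $$K_5,\; K_{1,4},\; K_{2,3},\; K_3\vee\overline{K}_2,\; K_2\vee\overline{K}_3,\; K_1\vee(K_3\cup K_1),\; K_2\vee(K_2\cup K_1);$$ (4) $n=6$ and $G$ is isomorphic to a graph with vertex set $\{a,b,c,d,e,f\}$ and edge set $E(H)\cup E(K)\cup\{ac,ad,bd,be\}$, where $H$ is an arbitrary graph with vertex set $\{a,b\}$ and $K$ is an arbitrary graph with vertex set $\{c,d,e,f\}$. (Identifications of graphs are up to isomorphism.)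
   Context: All graphs are finite and simple (not necessarily connected); the order of a graph is its number of vertices. $\overline{G}$ denotes the complement of $G$, $K_s$ the complete graph on $s$ vertices, and $K_{s,t}$ the complete bipartite graph with parts of sizes $s$ and $t$. For graphs $G,H$ with disjoint vertex sets, $G\cup H$ is their disjoint union, and the join $G\vee H$ is obtained from $G\cup H$ by adding all edges $uv$ with $u\in V(G)$, $v\in V(H)$. The edge between adjacent vertices $u$ and $v$ is written $uv$. For a graph $G$ and vertices $x,y\in V(G)$, put $a_G(x,y)=0$ if $x=y$, $a_G(x,y)=1$ if $x$ and $y$ are adjacent, and $a_G(x,y)=2$ otherwise. For a set $W=\{w_1,\ldots,w_k\}\subseteq V(G)$ and a vertex $v\in V(G)$, the adjacency representation of $v$ with respect to $W$ is the $k$-vector $r_2(v|W)=(a_G(v,w_1),\ldots,a_G(v,w_k))$. The set $W$ is an adjacency resolving set for $G$ if the vectors $r_2(v|W)$, $v\in V(G)$, are pairwise distinct. The adjacency dimension $\dim_2(G)$ is the minimum cardinality of an adjacency resolving set for $G$. *)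

theory Defs
  imports "Graph_Theory.Graph_Theory"
begin

text \<open>
  A finite simple graph is a \<open>'a pair_pre_digraph\<close> satisfying the locale predicate \<open>pair_graph\<close>
  (finite, symmetric, loop-free); an edge \<open>uv\<close> is the pair of arcs \<open>(u, v)\<close> and \<open>(v, u)\<close>.
\<close>

abbreviation graph_iso :: "'a pair_pre_digraph \<Rightarrow> 'b pair_pre_digraph \<Rightarrow> bool" where
  "graph_iso G H \<equiv> digraph_iso (with_proj G) (with_proj H)"

definition graph_compl :: "'a pair_pre_digraph \<Rightarrow> 'a pair_pre_digraph" where
  "graph_compl G = \<lparr> pverts = pverts G,
     parcs = {(u, v). u \<in> pverts G \<and> v \<in> pverts G \<and> u \<noteq> v \<and> (u, v) \<notin> parcs G} \<rparr>"

definition complete_graph :: "nat \<Rightarrow> nat pair_pre_digraph" where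
  "complete_graph n = \<lparr> pverts = {..<n}, parcs = {(u, v). u < n \<and> v < n \<and> u \<noteq> v} \<rparr>"

definition complete_bipartite_graph :: "nat \<Rightarrow> nat \<Rightarrow> (nat + nat) pair_pre_digraph" where
  "complete_bipartite_graph s t =
     (let U = Inl ` {..<s}; V = Inr ` {..<t}
      in \<lparr> pverts = U \<union> V, parcs = U \<times> V \<union> V \<times> U \<rparr>)"

text \<open>The sum type makes the vertex sets of the two operands disjoint.\<close>

definition disjoint_union ::
    "'a pair_pre_digraph \<Rightarrow> 'b pair_pre_digraph \<Rightarrow> ('a + 'b) pair_pre_digraph" where
  "disjoint_union G H = \<lparr> pverts = Inl ` pverts G \<union> Inr ` pverts H,
     parcs = map_prod Inl Inl ` parcs G \<union> map_prod Inr Inr ` parcs H \<rparr>"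

definition graph_join ::
    "'a pair_pre_digraph \<Rightarrow> 'b pair_pre_digraph \<Rightarrow> ('a + 'b) pair_pre_digraph" where
  "graph_join G H = \<lparr> pverts = pverts (disjoint_union G H),
     parcs = parcs (disjoint_union G H)
       \<union> Inl ` pverts G \<times> Inr ` pverts H \<union> Inr ` pverts H \<times> Inl ` pverts G \<rparr>"

definition adj_dist :: "'a pair_pre_digraph \<Rightarrow> 'a \<Rightarrow> 'a \<Rightarrow> nat" where
  "adj_dist G x y = (if x = y then 0 else if (x, y) \<in> parcs G then 1 else 2)"

text \<open>
  The representation of \<open>v\<close> with respect to \<open>W\<close> is a vector indexed by the elements of \<open>W\<close> itself,
  that is, a function on \<open>W\<close>, so no enumeration of \<open>W\<close> has to be chosen.
\<close>

definition adj_rep :: "'a pair_pre_digraph \<Rightarrow> 'a set \<Rightarrow> 'a \<Rightarrow> 'a \<Rightarrow> nat" where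
  "adj_rep G W v = restrict (adj_dist G v) W"

definition adj_resolving :: "'a pair_pre_digraph \<Rightarrow> 'a set \<Rightarrow> bool" where
  "adj_resolving G W \<longleftrightarrow> W \<subseteq> pverts G \<and> inj_on (adj_rep G W) (pverts G)"

definition adj_dim :: "'a pair_pre_digraph \<Rightarrow> nat" where
  "adj_dim G = (LEAST k. \<exists>W. adj_resolving G W \<and> card W = k)"

definition six_vertex_graph ::
    "'a \<Rightarrow> 'a \<Rightarrow> 'a \<Rightarrow> 'a \<Rightarrow> 'a \<Rightarrow> 'a \<Rightarrow> 'a pair_pre_digraph \<Rightarrow> 'a pair_pre_digraph \<Rightarrow> 'a pair_pre_digraph"
  where
  "six_vertex_graph a b c d e f H K = \<lparr> pverts = {a, b, c, d, e, f},
     parcs = parcs H \<union> parcs K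
       \<union> {(a, c), (a, d), (b, d), (b, e)} \<union> {(c, a), (d, a), (d, b), (e, b)} \<rparr>"

lemma complete_graph_complete_digraph: "complete_digraph n (with_proj (complete_graph n))"
  unfolding complete_digraph_pair_def by (auto simp: complete_graph_def)

lemma complete_bipartite_graph_complete_bipartite_digraph:
  "complete_bipartite_digraph s t (with_proj (complete_bipartite_graph s t))"
  unfolding complete_bipartite_digraph_pair_def complete_bipartite_graph_def Let_def
  by (intro conjI exI[of _ "Inl ` {..<s}"] exI[of _ "Inr ` {..<t}"]) (auto simp: card_image)

lemma pair_graphI:
  assumes "finite (pverts G)"
    and "\<And>u v. (u, v) \<in> parcs G \<Longrightarrow> u \<in> pverts G \<and> v \<in> pverts G \<and> u \<noteq> v \<and> (v, u) \<in> parcs G"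
  shows "pair_graph G"
proof -
  have "parcs G \<subseteq> pverts G \<times> pverts G" using assms(2) by auto
  then have "finite (parcs G)" using assms(1) by (meson finite_SigmaI finite_subset)
  then show ?thesis using assms
    by unfold_locales (auto simp: symmetric_def intro!: symI)
qed

lemma pair_graphD:
  assumes "pair_graph G"
  shows "finite (pverts G)"
    and "(u, v) \<in> parcs G \<Longrightarrow> u \<in> pverts G \<and> v \<in> pverts G \<and> u \<noteq> v \<and> (v, u) \<in> parcs G"
proof -
  interpret pair_graph G by fact
  show "finite (pverts G)" by (rule pair_finite_verts)
  show "(u, v) \<in> parcs G \<Longrightarrow> u \<in> pverts G \<and> v \<in> pverts G \<and> u \<noteq> v \<and> (v, u) \<in> parcs G"
    using in_arcsD1 in_arcsD2 pair_no_loops pair_sym_arcs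
    by (fastforce simp: symmetric_def dest: symD)
qed

lemma pair_graph_complete_graph: "pair_graph (complete_graph n)"
  by (rule pair_graphI) (auto simp: complete_graph_def)

lemma pair_graph_complete_bipartite_graph: "pair_graph (complete_bipartite_graph s t)"
  by (rule pair_graphI) (auto simp: complete_bipartite_graph_def)

lemma pair_graph_graph_compl: "pair_graph G \<Longrightarrow> pair_graph (graph_compl G)"
  by (rule pair_graphI) (auto simp: graph_compl_def dest: pair_graphD)

lemma pair_graph_disjoint_union:
  assumes "pair_graph G" "pair_graph H"
  shows "pair_graph (disjoint_union G H)"
proof (rule pair_graphI)
  show "finite (pverts (disjoint_union G H))"
    using assms by (simp add: disjoint_union_def pair_graphD(1))
next
  fix u v assume "(u, v) \<in> parcs (disjoint_union G H)"
  then consider (l) x y where "u = Inl x" "v = Inl y" "(x, y) \<in> parcs G"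
    | (r) x y where "u = Inr x" "v = Inr y" "(x, y) \<in> parcs H"
    by (auto simp: disjoint_union_def)
  then show "u \<in> pverts (disjoint_union G H) \<and> v \<in> pverts (disjoint_union G H)
      \<and> u \<noteq> v \<and> (v, u) \<in> parcs (disjoint_union G H)"
  proof cases
    case l
    then show ?thesis using pair_graphD(2)[OF assms(1) l(3)]
      by (force simp: disjoint_union_def)
  next
    case r
    then show ?thesis using pair_graphD(2)[OF assms(2) r(3)]
      by (force simp: disjoint_union_def)
  qed
qed

lemma pair_graph_graph_join:
  assumes "pair_graph G" "pair_graph H"
  shows "pair_graph (graph_join G H)"
proof (rule pair_graphI)
  note U = pair_graph_disjoint_union[OF assms]
  show "finite (pverts (graph_join G H))"
    using pair_graphD(1)[OF U] by (simp add: graph_join_def)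
  fix u v assume "(u, v) \<in> parcs (graph_join G H)"
  then consider "(u, v) \<in> parcs (disjoint_union G H)"
    | "(u, v) \<in> Inl ` pverts G \<times> Inr ` pverts H \<union> Inr ` pverts H \<times> Inl ` pverts G"
    by (auto simp: graph_join_def)
  then show "u \<in> pverts (graph_join G H) \<and> v \<in> pverts (graph_join G H)
      \<and> u \<noteq> v \<and> (v, u) \<in> parcs (graph_join G H)"
  proof cases
    case 1
    then show ?thesis using pair_graphD(2)[OF U 1] by (simp add: graph_join_def)
  next
    case 2
    then show ?thesis by (auto simp: graph_join_def disjoint_union_def)
  qed
qed

lemma graph_iso_iff:
  assumes "pair_graph G" "pair_graph H"
  shows "graph_iso G H \<longleftrightarrow> (\<exists>f. bij_betw f (pverts G) (pverts H)
    \<and> (\<forall>u \<in> pverts G. \<forall>v \<in> pverts G. (u, v) \<in> parcs G \<longleftrightarrow> (f u, f v) \<in> parcs H))"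
    (is "?L \<longleftrightarrow> ?R")
proof
  interpret pair_graph G by (rule assms(1))
  assume ?L
  then obtain h where h: "digraph_isomorphism h" "with_proj H = app_iso h (with_proj G)"
    unfolding digraph_iso_def by blast
  have vH: "pverts H = iso_verts h ` pverts G" and aH: "parcs H = iso_arcs h ` parcs G"
    and tH: "iso_tail h = fst" and hH: "iso_head h = snd"
    using arg_cong[OF h(2), of verts] arg_cong[OF h(2), of arcs]
      arg_cong[OF h(2), of tail] arg_cong[OF h(2), of head] by simp_all
  have inj: "inj_on (iso_verts h) (pverts G)"
    and arc: "\<And>e. e \<in> parcs G \<Longrightarrow> iso_arcs h e = (iso_verts h (fst e), iso_verts h (snd e))"
    using h(1) tH hH by (auto simp: digraph_isomorphism_def prod_eq_iff)
  have "(u, v) \<in> parcs G \<longleftrightarrow> (iso_verts h u, iso_verts h v) \<in> parcs H"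
    if uv: "u \<in> pverts G" "v \<in> pverts G" for u v
  proof
    assume "(u, v) \<in> parcs G"
    then show "(iso_verts h u, iso_verts h v) \<in> parcs H" using arc[of "(u, v)"] aH by force
  next
    assume "(iso_verts h u, iso_verts h v) \<in> parcs H"
    then obtain x y where xy: "(x, y) \<in> parcs G" "iso_verts h u = iso_verts h x"
      "iso_verts h v = iso_verts h y" using aH arc by auto
    then show "(u, v) \<in> parcs G" using inj uv in_arcsD1[OF xy(1)] in_arcsD2[OF xy(1)]
      by (auto dest: inj_onD)
  qed
  then show ?R using inj vH by (auto simp: bij_betw_def intro!: exI[of _ "iso_verts h"])
next
  interpret pair_graph G by (rule assms(1))
  assume ?R
  then obtain f where f: "bij_betw f (pverts G) (pverts H)"
    "\<And>u v. u \<in> pverts G \<Longrightarrow> v \<in> pverts G \<Longrightarrow> (u, v) \<in> parcs G \<longleftrightarrow> (f u, f v) \<in> parcs H" by blast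
  let ?h = "\<lparr>iso_verts = f, iso_arcs = map_prod f f, iso_head = snd, iso_tail = fst\<rparr>"
  have inj: "inj_on f (pverts G)" and im: "f ` pverts G = pverts H"
    using f(1) by (auto simp: bij_betw_def)
  have sub: "parcs G \<subseteq> pverts G \<times> pverts G" using in_arcsD1 in_arcsD2 by auto
  have "inj_on (map_prod f f) (parcs G)"
    using map_prod_inj_on[OF inj inj] sub by (rule inj_on_subset)
  then have iso: "digraph_isomorphism ?h"
    using inj wf_digraph by (auto simp: digraph_isomorphism_def)
  have "parcs H = map_prod f f ` parcs G"
  proof (intro equalityI subsetI)
    fix e assume e: "e \<in> parcs H"
    obtain p q where pq: "e = (p, q)" by fastforce
    have "p \<in> pverts H" "q \<in> pverts H" using pair_graphD(2)[OF assms(2)] e pq by blast+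
    then obtain u v where "p = f u" "q = f v" "u \<in> pverts G" "v \<in> pverts G" using im by blast
    then show "e \<in> map_prod f f ` parcs G" using f(2) e pq by force
  next
    fix e assume "e \<in> map_prod f f ` parcs G"
    then show "e \<in> parcs H" using f(2) sub by auto
  qed
  then have "with_proj H = app_iso ?h (with_proj G)"
    using im by (simp add: app_iso_def with_proj_def)
  then show ?L using iso unfolding digraph_iso_def by blast
qed

lemma adj_resolving_pverts: "adj_resolving G (pverts G)"
proof -
  have "u = v" if "u \<in> pverts G" "v \<in> pverts G" "adj_rep G (pverts G) u = adj_rep G (pverts G) v" for u v
    using fun_cong[OF that(3), of v] that(1,2) by (simp add: adj_rep_def adj_dist_def split: if_splits)
  then show ?thesis by (auto simp: adj_resolving_def inj_on_def)
qed

end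

theory Submission
  imports Defs
begin

text \<open>
  A resolving set \<open>W\<close> separates the vertices outside it by their neighbourhoods in \<open>W\<close>, so a graph
  with a resolving pair has at most \<open>2 + 2\<^sup>2 = 6\<close> vertices. If it has exactly six, all four
  subsets of the pair occur as neighbourhoods, which forces the edges between the pair and the rest
  while leaving all other edges free. The graphs on \<open>n \<le> 5\<close> vertices are copied onto \<open>{0, \<dots>, n - 1}\<close> and
  decided by running through all edge sets. For \<open>n = 5\<close> the run exhibits a resolving pair or an
  isomorphism of the graph or of its complement with an exceptional graph; that these
  alternatives exclude each other follows because the dimension is invariant under isomorphism and
  complementation and the exceptional graphs have no resolving pair.
\<close>

section \<open>Isomorphism of graphs and complementation\<close>

lemma graph_iso_sym:
  assumes "pair_graph G" "pair_graph H" "graph_iso G H"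
  shows "graph_iso H G"
proof -
  obtain f where f: "bij_betw f (pverts G) (pverts H)"
    "\<And>u v. u \<in> pverts G \<Longrightarrow> v \<in> pverts G \<Longrightarrow> (u, v) \<in> parcs G \<longleftrightarrow> (f u, f v) \<in> parcs H"
    using assms graph_iso_iff by metis
  let ?g = "inv_into (pverts G) f"
  have g: "bij_betw ?g (pverts H) (pverts G)"
    using f(1) by (rule bij_betw_inv_into)
  moreover have "(u, v) \<in> parcs H \<longleftrightarrow> (?g u, ?g v) \<in> parcs G"
    if "u \<in> pverts H" "v \<in> pverts H" for u v
    using that f(2)[of "?g u" "?g v"] bij_betwE[OF g] bij_betw_inv_into_right[OF f(1)] by simp
  ultimately show ?thesis
    using graph_iso_iff[OF assms(2,1)] by blast
qed

lemma graph_iso_trans: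
  assumes "pair_graph G" "pair_graph H" "pair_graph K" "graph_iso G H" "graph_iso H K"
  shows "graph_iso G K"
proof -
  obtain f where f: "bij_betw f (pverts G) (pverts H)"
    "\<And>u v. u \<in> pverts G \<Longrightarrow> v \<in> pverts G \<Longrightarrow> (u, v) \<in> parcs G \<longleftrightarrow> (f u, f v) \<in> parcs H"
    using assms graph_iso_iff by metis
  obtain g where g: "bij_betw g (pverts H) (pverts K)"
    "\<And>u v. u \<in> pverts H \<Longrightarrow> v \<in> pverts H \<Longrightarrow> (u, v) \<in> parcs H \<longleftrightarrow> (g u, g v) \<in> parcs K"
    using assms graph_iso_iff by metis
  have "bij_betw (g \<circ> f) (pverts G) (pverts K)"
    using f(1) g(1) by (rule bij_betw_trans)
  moreover have "(u, v) \<in> parcs G \<longleftrightarrow> ((g \<circ> f) u, (g \<circ> f) v) \<in> parcs K"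
    if "u \<in> pverts G" "v \<in> pverts G" for u v
    using that f(2) g(2) bij_betwE[OF f(1)] by simp
  ultimately show ?thesis
    using graph_iso_iff[OF assms(1,3)] by blast
qed

lemma graph_iso_graph_compl:
  assumes "pair_graph G" "pair_graph H" "graph_iso G H"
  shows "graph_iso (graph_compl G) (graph_compl H)"
proof -
  obtain f where f: "bij_betw f (pverts G) (pverts H)"
    "\<And>u v. u \<in> pverts G \<Longrightarrow> v \<in> pverts G \<Longrightarrow> (u, v) \<in> parcs G \<longleftrightarrow> (f u, f v) \<in> parcs H"
    using assms graph_iso_iff by metis
  have "bij_betw f (pverts (graph_compl G)) (pverts (graph_compl H))"
    using f(1) by (simp add: graph_compl_def)
  moreover have "(u, v) \<in> parcs (graph_compl G) \<longleftrightarrow> (f u, f v) \<in> parcs (graph_compl H)"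
    if "u \<in> pverts G" "v \<in> pverts G" for u v
    using that f(2) bij_betwE[OF f(1)] inj_on_eq_iff[OF bij_betw_imp_inj_on[OF f(1)]]
    by (simp add: graph_compl_def)
  ultimately show ?thesis
    using graph_iso_iff[OF pair_graph_graph_compl pair_graph_graph_compl] assms(1,2)
    by (metis (no_types, lifting) graph_compl_def pair_pre_digraph.select_convs(1))
qed

section \<open>Invariance of resolving sets and of the dimension\<close>

lemma adj_resolving_iff:
  "adj_resolving G W \<longleftrightarrow> W \<subseteq> pverts G \<and>
     (\<forall>u \<in> pverts G. \<forall>v \<in> pverts G. (\<forall>w \<in> W. adj_dist G u w = adj_dist G v w) \<longrightarrow> u = v)"
  \<comment> \<open>Outside \<open>W\<close>, \<open>restrict\<close> gives \<open>undefined\<close>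
    for both vertices, so only the coordinates in \<open>W\<close> can differ.\<close>
  unfolding adj_resolving_def inj_on_def adj_rep_def restrict_def fun_eq_iff
  by (rule conj_cong[OF refl]) metis

text \<open>An isomorphism preserves \<open>adj_dist\<close>, hence also which coordinates of two
  representations agree.\<close>

lemma adj_resolving_image:
  assumes "bij_betw f (pverts G) (pverts H)"
    and "\<And>u v. u \<in> pverts G \<Longrightarrow> v \<in> pverts G \<Longrightarrow> (u, v) \<in> parcs G \<longleftrightarrow> (f u, f v) \<in> parcs H"
    and "adj_resolving G W"
  shows "adj_resolving H (f ` W) \<and> card (f ` W) = card W"
proof -
  have inj: "inj_on f (pverts G)" and im: "f ` pverts G = pverts H"
    using assms(1) by (auto simp: bij_betw_def)
  have W: "W \<subseteq> pverts G" using assms(3) by (simp add: adj_resolving_def)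
  have "adj_dist H (f u) (f v) = adj_dist G u v" if "u \<in> pverts G" "v \<in> pverts G" for u v
    using that assms(2) inj_on_eq_iff[OF inj] by (simp add: adj_dist_def)
  then have "adj_resolving H (f ` W)"
    using assms(3) W unfolding adj_resolving_iff im[symmetric] by (auto simp: subset_iff)
  then show ?thesis using inj W by (auto intro: card_image inj_on_subset)
qed

lemma adj_dim_graph_iso:
  assumes "pair_graph G" "pair_graph H" "graph_iso G H"
  shows "adj_dim G = adj_dim H"
proof -
  \<comment> \<open>Stated for fresh types, because it is applied from \<open>G\<close> to
    \<open>H\<close> and, along the inverse isomorphism, back.\<close>
  have imp: "\<exists>W. adj_resolving H W \<and> card W = k"
    if "graph_iso G H" "pair_graph G" "pair_graph H" "\<exists>W. adj_resolving G W \<and> card W = k"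
    for G :: "'c pair_pre_digraph" and H :: "'d pair_pre_digraph" and k
    using that adj_resolving_image graph_iso_iff[OF that(2,3)] by metis
  have "(\<exists>W. adj_resolving G W \<and> card W = k) \<longleftrightarrow> (\<exists>W. adj_resolving H W \<and> card W = k)" for k
    using imp[OF assms(3,1,2)] imp[OF graph_iso_sym[OF assms] assms(2,1)] by blast
  then show ?thesis by (simp add: adj_dim_def)
qed

text \<open>Complementation swaps the values 1 and 2 of \<open>adj_dist\<close> on vertices and
  fixes 0. Such a relabelling does not change which coordinates agree, so both graphs have the same
  resolving sets.\<close>

lemma adj_dim_graph_compl: "adj_dim (graph_compl G) = adj_dim G"
proof -
  have "adj_dist (graph_compl G) u w = adj_dist (graph_compl G) v w
      \<longleftrightarrow> adj_dist G u w = adj_dist G v w"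
    if "u \<in> pverts G" "v \<in> pverts G" "w \<in> pverts G" for u v w
    using that by (auto simp: adj_dist_def graph_compl_def)
  then have "adj_resolving (graph_compl G) W \<longleftrightarrow> adj_resolving G W" for W
    unfolding adj_resolving_iff by (auto simp: subset_iff graph_compl_def)
  then show ?thesis by (simp add: adj_dim_def)
qed

text \<open>The \<open>LEAST\<close> is attained, since the set of all vertices is
  resolving.\<close>

lemma adj_dim_eq_two_iff:
  assumes "finite (pverts G)"
  shows "adj_dim G = 2 \<longleftrightarrow>
    (\<exists>W. adj_resolving G W \<and> card W = 2) \<and> (\<forall>W. adj_resolving G W \<longrightarrow> 2 \<le> card W)"
    (is "_ \<longleftrightarrow> ?R")
proof
  assume dim: "adj_dim G = 2"
  have "\<exists>W. adj_resolving G W \<and> card W = adj_dim G"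
    unfolding adj_dim_def by (rule LeastI_ex) (use adj_resolving_pverts in blast)
  moreover have "adj_dim G \<le> card W" if "adj_resolving G W" for W
    unfolding adj_dim_def by (rule Least_le) (use that in blast)
  ultimately show ?R using dim by simp
next
  assume ?R
  then show "adj_dim G = 2" unfolding adj_dim_def by (intro Least_equality) auto
qed

section \<open>The bound on the order\<close>

text \<open>A vertex outside \<open>W\<close> has no coordinate 0, so its neighbourhood in
  \<open>W\<close> determines its whole representation.\<close>

lemma inj_on_neighbours_if_adj_resolving:
  assumes "adj_resolving G W"
  shows "inj_on (\<lambda>v. {w \<in> W. (v, w) \<in> parcs G}) (pverts G - W)"
proof (rule inj_onI)
  fix u v assume uv: "u \<in> pverts G - W" "v \<in> pverts G - W"
    and "{w \<in> W. (u, w) \<in> parcs G} = {w \<in> W. (v, w) \<in> parcs G}"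
  then have "\<forall>w \<in> W. adj_dist G u w = adj_dist G v w" by (auto simp: adj_dist_def)
  then show "u = v" using assms uv by (auto simp: adj_resolving_iff)
qed

lemma card_pverts_le_if_adj_resolving:
  assumes "finite (pverts G)" "adj_resolving G W"
  shows "card (pverts G) \<le> card W + 2 ^ card W"
proof -
  have W: "W \<subseteq> pverts G" "finite W"
    using assms finite_subset by (auto simp: adj_resolving_def)
  have "card (pverts G - W) \<le> card (Pow W)"
    by (rule card_inj_on_le[OF inj_on_neighbours_if_adj_resolving[OF assms(2)]]) (use W in auto)
  then show ?thesis using W assms(1) by (simp add: card_Diff_subset card_Pow)
qed

text \<open>Resolving sets of size 0 and 1 allow at most 1 and 3 vertices, so from order four on no
  smaller set competes with a resolving pair.\<close>

lemma adj_dim_eq_two_iff_ex: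
  assumes "finite (pverts G)" "4 \<le> card (pverts G)"
  shows "adj_dim G = 2 \<longleftrightarrow> (\<exists>W. adj_resolving G W \<and> card W = 2)"
proof -
  have "2 \<le> card W" if "adj_resolving G W" for W
  proof (rule ccontr)
    assume "\<not> 2 \<le> card W"
    then have "card W = 0 \<or> card W = 1" by auto
    then show False
      using card_pverts_le_if_adj_resolving[OF assms(1) that] assms(2) by auto
  qed
  then show ?thesis using adj_dim_eq_two_iff[OF assms(1)] by blast
qed

section \<open>Order six\<close>

lemma pair_graph_six_vertex_graph:
  assumes "distinct [a, b, c, d, e, f]"
    and "pair_graph H" "pverts H = {a, b}" "pair_graph K" "pverts K = {c, d, e, f}"
  shows "pair_graph (six_vertex_graph a b c d e f H K)"
proof (rule pair_graphI)
  fix u v assume "(u, v) \<in> parcs (six_vertex_graph a b c d e f H K)"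
  then consider "(u, v) \<in> parcs H" | "(u, v) \<in> parcs K"
    | "(u, v) \<in> {(a, c), (a, d), (b, d), (b, e)} \<union> {(c, a), (d, a), (d, b), (e, b)}"
    by (auto simp: six_vertex_graph_def)
  then show "u \<in> pverts (six_vertex_graph a b c d e f H K)
      \<and> v \<in> pverts (six_vertex_graph a b c d e f H K)
      \<and> u \<noteq> v \<and> (v, u) \<in> parcs (six_vertex_graph a b c d e f H K)"
  proof cases
    case 1
    then show ?thesis using pair_graphD(2)[OF assms(2) 1] assms(3)
      by (auto simp: six_vertex_graph_def)
  next
    case 2
    then show ?thesis using pair_graphD(2)[OF assms(4) 2] assms(5)
      by (auto simp: six_vertex_graph_def)
  next
    case 3
    then show ?thesis using assms(1) by (auto simp: six_vertex_graph_def)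
  qed
qed (simp add: six_vertex_graph_def)

text \<open>The pair \<open>{a, b}\<close> resolves: the neighbourhoods of \<open>c\<close>,
  \<open>d\<close>, \<open>e\<close>, \<open>f\<close> in it are \<open>{a}\<close>,
  \<open>{a, b}\<close>, \<open>{b}\<close> and \<open>{}\<close>, while \<open>a\<close> and
  \<open>b\<close> are recognised by their coordinate 0.\<close>

lemma adj_dim_six_vertex_graph:
  assumes "distinct [a, b, c, d, e, f]"
    and "pair_graph H" "pverts H = {a, b}" "pair_graph K" "pverts K = {c, d, e, f}"
  shows "adj_dim (six_vertex_graph a b c d e f H K) = 2"
proof -
  let ?S = "six_vertex_graph a b c d e f H K"
  have V: "pverts ?S = {a, b, c, d, e, f}" by (simp add: six_vertex_graph_def)
  \<comment> \<open>Neither \<open>H\<close> nor \<open>K\<close> contributes an edge between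
    \<open>{a, b}\<close> and the other four vertices, so the fixed arcs alone decide these
    adjacencies.\<close>
  have H: "(u, v) \<notin> parcs H" if "u \<in> {c, d, e, f}" for u v
    using pair_graphD(2)[OF assms(2), of u v] assms(1,3) that by auto
  have K: "(u, v) \<notin> parcs K" if "v \<in> {a, b}" for u v
    using pair_graphD(2)[OF assms(4), of u v] assms(1,5) that by auto
  have neq: "a \<noteq> b" "a \<noteq> c" "a \<noteq> d" "a \<noteq> e" "a \<noteq> f" "b \<noteq> c" "b \<noteq> d" "b \<noteq> e" "b \<noteq> f"
    "c \<noteq> d" "c \<noteq> e" "c \<noteq> f" "d \<noteq> e" "d \<noteq> f" "e \<noteq> f"
    using assms(1) by simp_all
  have "adj_resolving ?S {a, b}"
    unfolding adj_resolving_iff V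
    by (simp add: adj_dist_def six_vertex_graph_def H K neq neq[symmetric])
  moreover have "card {a, b} = 2" using assms(1) by simp
  moreover have "finite (pverts ?S)" "4 \<le> card (pverts ?S)"
    unfolding V using assms(1) by simp_all
  ultimately show ?thesis
    using adj_dim_eq_two_iff_ex by blast
qed

text \<open>Four vertices lie outside a resolving pair, and the pair has four subsets, so the
  injective neighbourhood map is onto. The preimages of \<open>{a}\<close>, \<open>{a, b}\<close>,
  \<open>{b}\<close> and \<open>{}\<close> serve as \<open>c\<close>, \<open>d\<close>,
  \<open>e\<close>, \<open>f\<close>; the remaining edges of \<open>G\<close> go into
  \<open>H\<close> and \<open>K\<close>.\<close>

lemma graph_iso_six_vertex_graph_if_adj_dim_two:
  assumes G: "pair_graph G" and n: "card (pverts G) = 6" and dim: "adj_dim G = 2"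
  shows "\<exists>(a::nat) b c d e f H K. distinct [a, b, c, d, e, f]
    \<and> pair_graph H \<and> pverts H = {a, b} \<and> pair_graph K \<and> pverts K = {c, d, e, f}
    \<and> graph_iso G (six_vertex_graph a b c d e f H K)"
proof -
  note fin = pair_graphD(1)[OF G]
  obtain W where W: "adj_resolving G W" "card W = 2"
    using dim adj_dim_eq_two_iff[OF fin] by blast
  have WV: "W \<subseteq> pverts G" using W(1) by (simp add: adj_resolving_def)
  obtain a b where ab: "W = {a, b}" "a \<noteq> b" using W(2) by (auto simp: card_2_iff)
  define N where "N v = {w \<in> W. (v, w) \<in> parcs G}" for v
  have NW: "N ` (pverts G - W) = Pow W"
  proof (rule card_subset_eq)
    have "card (N ` (pverts G - W)) = card (pverts G - W)"
      unfolding N_def by (rule card_image[OF inj_on_neighbours_if_adj_resolving[OF W(1)]])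
    also have "\<dots> = 4" using W(2) WV n ab by (simp add: card_Diff_subset)
    also have "\<dots> = card (Pow W)" using W(2) ab by (simp add: card_Pow)
    finally show "card (N ` (pverts G - W)) = card (Pow W)" .
    show "finite (Pow W)" by (simp add: ab)
    show "N ` (pverts G - W) \<subseteq> Pow W" unfolding N_def by blast
  qed
  have surj: "\<exists>v. v \<in> pverts G \<and> v \<notin> W \<and> N v = U" if "U \<subseteq> W" for U
  proof -
    have "U \<in> N ` (pverts G - W)" using that NW by simp
    then show ?thesis by blast
  qed
  obtain c where c: "c \<in> pverts G" "c \<notin> W" "N c = {a}" using surj[of "{a}"] ab(1) by blast
  obtain d where d: "d \<in> pverts G" "d \<notin> W" "N d = {a, b}" using surj[of "{a, b}"] ab(1) by blast
  obtain e where e: "e \<in> pverts G" "e \<notin> W" "N e = {b}" using surj[of "{b}"] ab(1) by blast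
  obtain f where f: "f \<in> pverts G" "f \<notin> W" "N f = {}" using surj[of "{}"] by blast
  have dist: "distinct [a, b, c, d, e, f]" using c d e f ab by auto
  have V: "pverts G = {a, b, c, d, e, f}"
  proof (rule card_subset_eq[OF fin, symmetric])
    show "{a, b, c, d, e, f} \<subseteq> pverts G" using c d e f ab WV by auto
    show "card {a, b, c, d, e, f} = card (pverts G)" using n dist by simp
  qed
  have arcs: "(c, a) \<in> parcs G" "(c, b) \<notin> parcs G" "(d, a) \<in> parcs G" "(d, b) \<in> parcs G"
    "(e, a) \<notin> parcs G" "(e, b) \<in> parcs G" "(f, a) \<notin> parcs G" "(f, b) \<notin> parcs G"
    using c(3) d(3) e(3) f(3) ab by (auto simp: N_def)
  have sym: "(u, v) \<in> parcs G \<longleftrightarrow> (v, u) \<in> parcs G" for u v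
    using pair_graphD(2)[OF G] by blast
  \<comment> \<open>The target graph lives on natural numbers: \<open>q\<close> names the vertices
    of \<open>G\<close> by 0 to 5, and \<open>ind S\<close> is the subgraph of \<open>G\<close>
    induced on the image of \<open>S\<close>, pulled back along \<open>q\<close>.\<close>
  define q where "q i = [a, b, c, d, e, f] ! i" for i :: nat
  define ind where "ind S = \<lparr>pverts = S, parcs = {(i, j). i \<in> S \<and> j \<in> S \<and> (q i, q j) \<in> parcs G}\<rparr>"
    for S :: "nat set"
  have ind: "pair_graph (ind S)" "pverts (ind S) = S" if "finite S" for S
  proof -
    show "pair_graph (ind S)"
      by (rule pair_graphI) (use that pair_graphD(2)[OF G] in \<open>auto simp: ind_def\<close>)
  qed (simp add: ind_def)
  let ?S = "six_vertex_graph 0 1 2 3 4 5 (ind {0, 1}) (ind {2, 3, 4, 5})"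
  have S: "pair_graph ?S" by (rule pair_graph_six_vertex_graph) (auto simp: ind)
  have vS: "pverts ?S = {0, 1, 2, 3, 4, 5}" by (simp add: six_vertex_graph_def)
  \<comment> \<open>The simplifier turns \<open>1\<close> into \<open>Suc 0\<close>, hence the
    second equation for \<open>b\<close>.\<close>
  have q: "q 0 = a" "q 1 = b" "q (Suc 0) = b" "q 2 = c" "q 3 = d" "q 4 = e" "q 5 = f"
    by (simp_all add: q_def)
  have "graph_iso ?S G"
    unfolding graph_iso_iff[OF S G]
  proof (intro exI[of _ q] conjI)
    show "bij_betw q (pverts ?S) (pverts G)"
      using dist unfolding V vS by (auto simp: bij_betw_def inj_on_def q)
    show "\<forall>u \<in> pverts ?S. \<forall>v \<in> pverts ?S. (u, v) \<in> parcs ?S \<longleftrightarrow> (q u, q v) \<in> parcs G"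
      \<comment> \<open>The unfolded copy of \<open>arcs\<close> supplies the same facts for the
        reversed arcs, which start at \<open>a\<close> or \<open>b\<close>.\<close>
      unfolding vS using arcs arcs[unfolded sym[of _ a] sym[of _ b]]
      by (simp add: six_vertex_graph_def ind_def q)
  qed
  then have "graph_iso G ?S" by (rule graph_iso_sym[OF S G])
  moreover have "distinct [0, 1, 2, 3, 4, 5 :: nat]" by simp
  ultimately show ?thesis using ind by (metis finite.emptyI finite.insertI)
qed

section \<open>Order at most five\<close>

definition vertex_pairs :: "nat \<Rightarrow> (nat \<times> nat) list" where
  "vertex_pairs n = [(i, j). j \<leftarrow> [0..<n], i \<leftarrow> [0..<j]]"

text \<open>Only pairs \<open>(i, j)\<close> with \<open>i < j\<close> count as edges; reversed pairs in the list are ignored.\<close>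

definition edge_dist :: "(nat \<times> nat) list \<Rightarrow> nat \<Rightarrow> nat \<Rightarrow> nat" where
  "edge_dist es i j =
     (if i = j then 0
      else if i < j then (if (i, j) \<in> set es then 1 else 2)
      else if (j, i) \<in> set es then 1 else 2)"

definition edge_graph :: "nat \<Rightarrow> (nat \<times> nat) list \<Rightarrow> nat pair_pre_digraph" where
  "edge_graph n es =
     \<lparr>pverts = {..<n}, parcs = {(i, j). i < n \<and> j < n \<and> edge_dist es i j = 1}\<rparr>"

definition edge_compl :: "nat \<Rightarrow> (nat \<times> nat) list \<Rightarrow> (nat \<times> nat) list" where
  "edge_compl n es = filter (\<lambda>(i, j). edge_dist es i j = 2) (vertex_pairs n)"

definition resolves :: "nat \<Rightarrow> (nat \<times> nat) list \<Rightarrow> nat list \<Rightarrow> bool" where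
  "resolves n es ws \<longleftrightarrow> distinct (map (\<lambda>v. map (edge_dist es v) ws) [0..<n])"

definition dim_two :: "nat \<Rightarrow> (nat \<times> nat) list \<Rightarrow> bool" where
  "dim_two n es \<longleftrightarrow> (\<exists>(i, j) \<in> set (vertex_pairs n). resolves n es [i, j])
     \<and> (\<forall>i \<in> set [0..<n]. \<not> resolves n es [i]) \<and> \<not> resolves n es []"

text \<open>
  Backtracking search: \<open>qs\<close> lists the images of the first vertices, and \<open>k\<close> vertices remain.
\<close>

fun extends_to_iso ::
    "nat \<Rightarrow> nat \<Rightarrow> (nat \<times> nat) list \<Rightarrow> (nat \<times> nat) list \<Rightarrow> nat list \<Rightarrow> bool" where
  "extends_to_iso 0 n es fs qs = True"
| "extends_to_iso (Suc k) n es fs qs = (\<exists>v \<in> set [0..<n]. v \<notin> set qs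
     \<and> (\<forall>i \<in> set [0..<length qs]. edge_dist es (length qs) i = edge_dist fs v (qs ! i))
     \<and> extends_to_iso k n es fs (qs @ [v]))"

text \<open>Quantifying by recursion keeps \<open>code_simp\<close> from building the list of all edge sets.\<close>

fun all_subseqs :: "('a list \<Rightarrow> bool) \<Rightarrow> 'a list \<Rightarrow> bool" where
  "all_subseqs P [] = P []"
| "all_subseqs P (x # xs) = (all_subseqs P xs \<and> all_subseqs (\<lambda>es. P (x # es)) xs)"

lemma all_subseqs_iff: "all_subseqs P xs \<longleftrightarrow> (\<forall>es \<in> set (subseqs xs). P es)"
  by (induction xs arbitrary: P) (auto simp: Let_def)

text \<open>
  \<open>code_simp\<close> normalises both arguments of \<open>\<and>\<close> and \<open>\<or>\<close>, but only the selected branch of a conditional.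
\<close>

lemma list_ex_lazy [code]:
  "list_ex P [] = False"
  "list_ex P (x # xs) = (if P x then True else list_ex P xs)"
  by simp_all

lemma extends_to_iso_lazy [code]:
  "extends_to_iso 0 n es fs qs = True"
  "extends_to_iso (Suc k) n es fs qs = (\<exists>v \<in> set [0..<n].
     if v \<in> set qs then False
     else if \<forall>i \<in> set [0..<length qs]. edge_dist es (length qs) i = edge_dist fs v (qs ! i)
     then extends_to_iso k n es fs (qs @ [v]) else False)"
  by auto

section \<open>Edge lists as graphs\<close>

lemma set_vertex_pairs: "set (vertex_pairs n) = {(i, j). i < j \<and> j < n}"
  by (auto simp: vertex_pairs_def)

lemma edge_dist_same [simp]: "edge_dist es i i = 0"
  by (simp add: edge_dist_def)

lemma edge_dist_commute: "edge_dist es i j = edge_dist es j i"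
  by (auto simp: edge_dist_def)

lemma pverts_edge_graph [simp]: "pverts (edge_graph n es) = {..<n}"
  by (simp add: edge_graph_def)

lemma parcs_edge_graph:
  "(i, j) \<in> parcs (edge_graph n es) \<longleftrightarrow> i < n \<and> j < n \<and> edge_dist es i j = 1"
  by (simp add: edge_graph_def)

lemma pair_graph_edge_graph: "pair_graph (edge_graph n es)"
  by (rule pair_graphI) (auto simp: parcs_edge_graph edge_dist_commute intro: ccontr)

lemma adj_dist_edge_graph:
  "i < n \<Longrightarrow> j < n \<Longrightarrow> adj_dist (edge_graph n es) i j = edge_dist es i j"
  by (simp add: adj_dist_def parcs_edge_graph edge_dist_def)

lemma graph_compl_edge_graph: "graph_compl (edge_graph n es) = edge_graph n (edge_compl n es)"
proof -
  have "edge_dist (edge_compl n es) i j = 1 \<longleftrightarrow> i \<noteq> j \<and> edge_dist es i j \<noteq> 1"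
    if "i < n" "j < n" for i j
    using that unfolding edge_dist_def[of "edge_compl n es"]
    by (auto simp: edge_compl_def set_vertex_pairs edge_dist_def)
  then show ?thesis
    by (auto simp: graph_compl_def edge_graph_def)
qed

lemma complete_graph_eq_edge_graph: "complete_graph n = edge_graph n (vertex_pairs n)"
  by (auto simp: complete_graph_def edge_graph_def edge_dist_def set_vertex_pairs)

lemma graph_compl_complete_graph: "graph_compl (complete_graph n) = edge_graph n []"
  by (auto simp: complete_graph_def graph_compl_def edge_graph_def edge_dist_def)

lemma resolves_iff:
  assumes "set ws \<subseteq> {..<n}"
  shows "resolves n es ws \<longleftrightarrow> adj_resolving (edge_graph n es) (set ws)"
proof -
  have "adj_dist (edge_graph n es) u w = edge_dist es u w" if "u < n" "w \<in> set ws" for u w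
    using that assms adj_dist_edge_graph by auto
  then show ?thesis
    using assms by (auto simp: resolves_def distinct_map inj_on_def adj_resolving_iff)
qed

lemma ex_resolving_pair_iff:
  "(\<exists>(i, j) \<in> set (vertex_pairs n). resolves n es [i, j])
    \<longleftrightarrow> (\<exists>W. adj_resolving (edge_graph n es) W \<and> card W = 2)"
proof -
  let ?res = "adj_resolving (edge_graph n es)"
  have sub: "W \<subseteq> {..<n}" if "?res W" for W
    using that by (simp add: adj_resolving_def)
  have "(\<exists>(i, j) \<in> set (vertex_pairs n). resolves n es [i, j])
      \<longleftrightarrow> (\<exists>i j. i < j \<and> j < n \<and> resolves n es [i, j])"
    by (auto simp: set_vertex_pairs)
  also have "\<dots> \<longleftrightarrow> (\<exists>i j. i < j \<and> j < n \<and> ?res {i, j})"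
    by (intro ex_cong1 conj_cong refl) (simp add: resolves_iff)
  also have "\<dots> \<longleftrightarrow> (\<exists>W. ?res W \<and> card W = 2)"
  proof
    assume "\<exists>W. ?res W \<and> card W = 2"
    then obtain i j where ij: "?res {i, j}" "i \<noteq> j" by (auto simp: card_2_iff)
    then have "i < n" "j < n" using sub by auto
    then show "\<exists>i j. i < j \<and> j < n \<and> ?res {i, j}"
      using ij by (metis insert_commute linorder_neqE_nat)
  qed (metis card_2_iff less_irrefl)
  finally show ?thesis .
qed

text \<open>Makes the dimension computable: whatever evaluation yields for \<open>dim_two\<close>
  becomes a statement about \<open>adj_dim\<close>.\<close>

lemma dim_two_iff: "dim_two n es \<longleftrightarrow> adj_dim (edge_graph n es) = 2"
proof -
  let ?res = "adj_resolving (edge_graph n es)"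
  have sub: "W \<subseteq> {..<n}" if "?res W" for W
    using that by (simp add: adj_resolving_def)
  \<comment> \<open>The right side ranges over all numbers, but a singleton outside
    \<open>{..<n}\<close> is not a set of vertices and so never resolves.\<close>
  have one: "(\<forall>i \<in> set [0..<n]. \<not> resolves n es [i]) \<longleftrightarrow> (\<forall>i. \<not> ?res {i})"
    using resolves_iff[of "[_]" n es] sub by fastforce
  have zero: "resolves n es [] \<longleftrightarrow> ?res {}"
    using resolves_iff[of "[]" n es] by simp
  have "(\<forall>W. ?res W \<longrightarrow> 2 \<le> card W) \<longleftrightarrow> (\<forall>i. \<not> ?res {i}) \<and> \<not> ?res {}"
  proof
    assume R: "(\<forall>i. \<not> ?res {i}) \<and> \<not> ?res {}"
    have "2 \<le> card W" if "?res W" for W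
    proof (rule ccontr)
      assume "\<not> 2 \<le> card W"
      then have "card W = 0 \<or> card W = 1" by auto
      moreover have "finite W" using sub[OF that] finite_subset by blast
      ultimately show False using R that by (auto simp: card_1_singleton_iff)
    qed
    then show "\<forall>W. ?res W \<longrightarrow> 2 \<le> card W" by blast
  qed fastforce
  then show ?thesis
    unfolding dim_two_def ex_resolving_pair_iff one zero by (simp add: adj_dim_eq_two_iff)
qed

lemma Nil_in_set_subseqs: "[] \<in> set (subseqs xs)"
  by (induction xs) (simp_all add: Let_def)

text \<open>Enumerating the vertices by \<open>h\<close> pulls the edges back to a set of pairs
  \<open>(i, j)\<close> with \<open>i < j\<close>, and \<open>subseqs\<close> reaches every subset
  of these pairs.\<close>

lemma ex_graph_iso_edge_graph:
  assumes "pair_graph G" "card (pverts G) = n"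
  obtains es where "es \<in> set (subseqs (vertex_pairs n))" "graph_iso G (edge_graph n es)"
proof -
  obtain h where h: "bij_betw h {..<n} (pverts G)"
    using ex_bij_betw_nat_finite[OF pair_graphD(1)[OF assms(1)]] assms(2) by (auto simp: atLeast0LessThan)
  let ?E = "{(i, j). i < j \<and> j < n \<and> (h i, h j) \<in> parcs G}"
  have "?E \<in> set ` set (subseqs (vertex_pairs n))"
    unfolding subseqs_powset set_vertex_pairs by auto
  then obtain es where es: "es \<in> set (subseqs (vertex_pairs n))" "set es = ?E" by auto
  have "graph_iso (edge_graph n es) G"
    unfolding graph_iso_iff[OF pair_graph_edge_graph assms(1)]
  proof (intro exI[of _ h] conjI ballI)
    fix i j assume "i \<in> pverts (edge_graph n es)" "j \<in> pverts (edge_graph n es)"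
    then show "(i, j) \<in> parcs (edge_graph n es) \<longleftrightarrow> (h i, h j) \<in> parcs G"
      using pair_graphD(2)[OF assms(1)]
      by (cases i j rule: linorder_cases) (auto simp: parcs_edge_graph edge_dist_def es(2))
  qed (simp add: h)
  then show ?thesis
    using that es(1) graph_iso_sym[OF pair_graph_edge_graph assms(1)] by blast
qed

text \<open>Invariant of the search: \<open>j\<close> mapped to \<open>qs ! j\<close> is an
  injective partial map that preserves \<open>edge_dist\<close>. Once \<open>k = 0\<close>, its
  image has \<open>n\<close> elements and is all of \<open>{..<n}\<close>, so the map is an
  isomorphism.\<close>

lemma graph_iso_if_extends_to_iso:
  assumes "extends_to_iso k n es fs qs" "length qs + k = n" "distinct qs" "set qs \<subseteq> {..<n}"
    and "\<And>i j. j < length qs \<Longrightarrow> i < j \<Longrightarrow> edge_dist es j i = edge_dist fs (qs ! j) (qs ! i)"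
  shows "graph_iso (edge_graph n es) (edge_graph n fs)"
  using assms
proof (induction k arbitrary: qs)
  case 0
  then have len: "length qs = n" by simp
  have "set qs = {..<n}"
    using 0 by (intro card_subset_eq) (auto simp: distinct_card)
  then have "bij_betw ((!) qs) {..<n} {..<n}"
    using bij_betw_nth[OF 0(3) _ refl] len by simp
  moreover have "(u, v) \<in> parcs (edge_graph n es) \<longleftrightarrow> (qs ! u, qs ! v) \<in> parcs (edge_graph n fs)"
    if "u < n" "v < n" for u v
  proof -
    have "qs ! u < n" "qs ! v < n" using that len 0(4) nth_mem by blast+
    then show ?thesis
      \<comment> \<open>The invariant covers only one order of the two positions;
        \<open>edge_dist_commute\<close> gives the other.\<close>
      using that len 0(5)[of u v] 0(5)[of v u]
      by (cases u v rule: linorder_cases)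
        (auto simp: parcs_edge_graph edge_dist_commute[of _ u] edge_dist_commute[of _ "qs ! u"])
  qed
  ultimately show ?case
    unfolding graph_iso_iff[OF pair_graph_edge_graph pair_graph_edge_graph]
    by (intro exI[of _ "(!) qs"]) simp
next
  case (Suc k)
  then obtain v where v: "v < n" "v \<notin> set qs"
    "\<And>i. i < length qs \<Longrightarrow> edge_dist es (length qs) i = edge_dist fs v (qs ! i)"
    "extends_to_iso k n es fs (qs @ [v])" by auto
  show ?case
  proof (rule Suc.IH[OF v(4)])
    fix i j assume "j < length (qs @ [v])" "i < j"
    then show "edge_dist es j i = edge_dist fs ((qs @ [v]) ! j) ((qs @ [v]) ! i)"
      using Suc.prems(5) v(3) by (cases "j = length qs") (auto simp: nth_append)
  qed (use v(1,2) Suc.prems(2-4) in auto)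
qed

text \<open>
  The seven exceptional graphs of order five on the vertices \<open>0, \<dots>, 4\<close>, in the order of the theorem.
\<close>

definition exceptional_edges :: "(nat \<times> nat) list list" where
  "exceptional_edges = [
    vertex_pairs 5,
    [(0,1),(0,2),(0,3),(0,4)],
    [(0,2),(0,3),(0,4),(1,2),(1,3),(1,4)],
    [(0,1),(0,2),(1,2),(0,3),(1,3),(2,3),(0,4),(1,4),(2,4)],
    [(0,1),(0,2),(0,3),(0,4),(1,2),(1,3),(1,4)],
    [(0,1),(0,2),(0,3),(0,4),(1,2),(1,3),(2,3)],
    [(0,1),(0,2),(0,3),(0,4),(1,2),(1,3),(1,4),(2,3)]]"

section \<open>Exhaustive evaluation\<close>

lemma exceptional_not_dim_two: "\<forall>es \<in> set exceptional_edges. \<not> dim_two 5 es"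
  by code_simp

lemma not_dim_two_order_one: "\<forall>es \<in> set (subseqs (vertex_pairs 1)). \<not> dim_two 1 es"
  by code_simp

lemma not_dim_two_order_two: "\<forall>es \<in> set (subseqs (vertex_pairs 2)). \<not> dim_two 2 es"
  by code_simp

text \<open>The list equations stand for the complete and the edgeless graph: a sublist of the
  duplicate-free \<open>vertex_pairs\<close> is determined by its set of edges.\<close>

lemma dim_two_order_three:
  "\<forall>es \<in> set (subseqs (vertex_pairs 3)). dim_two 3 es \<longleftrightarrow> es = vertex_pairs 3 \<or> es = []"
  by code_simp

lemma dim_two_order_four:
  "\<forall>es \<in> set (subseqs (vertex_pairs 4)). dim_two 4 es \<longleftrightarrow> \<not> (es = vertex_pairs 4 \<or> es = [])"
  by code_simp

text \<open>The edge counts only prune the search.\<close>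

definition order_five_decided :: "(nat \<times> nat) list \<Rightarrow> bool" where
  "order_five_decided es =
    (if \<exists>(i, j) \<in> set (vertex_pairs 5). resolves 5 es [i, j] then True
     else \<exists>fs \<in> set exceptional_edges.
       if length es = length fs then
         if extends_to_iso 5 5 es fs [] then True
         else if length es = 5 then extends_to_iso 5 5 (edge_compl 5 es) fs [] else False
       else if length es + length fs = 10 then extends_to_iso 5 5 (edge_compl 5 es) fs [] else False)"

text \<open>Covers all \<open>2 ^ 10\<close> edge sets. Five vertices span 10 pairs, so an edge set
  and its complement have 10 edges together, which is the \<open>10\<close> in
  \<open>order_five_decided\<close>.\<close>

lemma all_order_five_decided: "all_subseqs order_five_decided (vertex_pairs 5)"
  by code_simp

text \<open>At order five a resolving pair already means dimension two, so the test for pairs in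
  \<open>order_five_decided\<close> can be replaced by \<open>dim_two\<close>.\<close>

lemma resolving_pair_or_exceptional:
  assumes "es \<in> set (subseqs (vertex_pairs 5))"
  shows "dim_two 5 es \<or> (\<exists>fs \<in> set exceptional_edges.
    extends_to_iso 5 5 es fs [] \<or> extends_to_iso 5 5 (edge_compl 5 es) fs [])"
proof -
  have "dim_two 5 es \<longleftrightarrow> (\<exists>(i, j) \<in> set (vertex_pairs 5). resolves 5 es [i, j])"
    unfolding dim_two_iff ex_resolving_pair_iff by (simp add: adj_dim_eq_two_iff_ex)
  moreover have "order_five_decided es"
    using all_order_five_decided assms unfolding all_subseqs_iff by blast
  ultimately show ?thesis unfolding order_five_decided_def by (auto split: if_splits)
qed

section \<open>The seven exceptional graphs as edge lists\<close>

lemma graph_iso_cong_right: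
  assumes "pair_graph G" "pair_graph H" "pair_graph K" "graph_iso H K"
  shows "graph_iso G H \<longleftrightarrow> graph_iso G K"
  using graph_iso_trans[OF assms(1-3) _ assms(4)]
    graph_iso_trans[OF assms(1,3,2) _ graph_iso_sym[OF assms(2-4)]] by (rule iffI)

lemmas pair_graph_intros = pair_graph_complete_graph pair_graph_complete_bipartite_graph
  pair_graph_graph_compl pair_graph_disjoint_union pair_graph_graph_join pair_graph_edge_graph

text \<open>The arc condition is phrased with \<open>edge_dist\<close>; the range conditions in the
  arcs of \<open>edge_graph\<close> follow from the bijection.\<close>

lemma graph_iso_edge_graphI:
  assumes "pair_graph G" "bij_betw f (pverts G) {..<n}"
    and "\<forall>u \<in> pverts G. \<forall>v \<in> pverts G. (u, v) \<in> parcs G \<longleftrightarrow> edge_dist es (f u) (f v) = 1"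
  shows "graph_iso G (edge_graph n es)"
  unfolding graph_iso_iff[OF assms(1) pair_graph_edge_graph]
  using assms(2,3) bij_betwE[OF assms(2)]
  by (intro exI[of _ f]) (auto simp: parcs_edge_graph)

lemma pverts_graph_join: "pverts (graph_join G H) = Inl ` pverts G \<union> Inr ` pverts H"
  by (simp add: graph_join_def disjoint_union_def)

lemma parcs_graph_join:
  "(Inl x, Inl y) \<in> parcs (graph_join G H) \<longleftrightarrow> (x, y) \<in> parcs G"
  "(Inr z, Inr w) \<in> parcs (graph_join G H) \<longleftrightarrow> (z, w) \<in> parcs H"
  "(Inl x, Inr z) \<in> parcs (graph_join G H) \<longleftrightarrow> x \<in> pverts G \<and> z \<in> pverts H"
  "(Inr z, Inl x) \<in> parcs (graph_join G H) \<longleftrightarrow> x \<in> pverts G \<and> z \<in> pverts H"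
  by (auto simp: graph_join_def disjoint_union_def)

lemma pverts_disjoint_union: "pverts (disjoint_union G H) = Inl ` pverts G \<union> Inr ` pverts H"
  by (simp add: disjoint_union_def)

lemma parcs_disjoint_union:
  "(Inl x, Inl y) \<in> parcs (disjoint_union G H) \<longleftrightarrow> (x, y) \<in> parcs G"
  "(Inr z, Inr w) \<in> parcs (disjoint_union G H) \<longleftrightarrow> (z, w) \<in> parcs H"
  "(Inl x, Inr z) \<notin> parcs (disjoint_union G H)"
  "(Inr z, Inl x) \<notin> parcs (disjoint_union G H)"
  by (auto simp: disjoint_union_def)

lemmas exceptional_simps = pverts_graph_join parcs_graph_join pverts_disjoint_union
  parcs_disjoint_union complete_graph_def complete_bipartite_graph_def graph_compl_def
  edge_dist_def bij_betw_def inj_on_def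
  image_iff Let_def numeral_eq_Suc lessThan_Suc

text \<open>Here and in the five lemmas that follow, the bijection numbers the components from left
  to right, shifting each by the number of vertices before it. This is the numbering of
  \<open>exceptional_edges\<close>.\<close>

lemma graph_iso_K_1_4:
  "graph_iso (complete_bipartite_graph 1 4) (edge_graph 5 [(0,1),(0,2),(0,3),(0,4)])"
  by (rule graph_iso_edge_graphI[where f = "case_sum (\<lambda>i. i) (\<lambda>j. 1 + j)"])
    (intro pair_graph_intros, simp_all add: exceptional_simps insert_commute)

lemma graph_iso_K_2_3:
  "graph_iso (complete_bipartite_graph 2 3) (edge_graph 5 [(0,2),(0,3),(0,4),(1,2),(1,3),(1,4)])"
  by (rule graph_iso_edge_graphI[where f = "case_sum (\<lambda>i. i) (\<lambda>j. 2 + j)"])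
    (intro pair_graph_intros, simp_all add: exceptional_simps insert_commute)

lemma graph_iso_K_3_join_co_K_2:
  "graph_iso (graph_join (complete_graph 3) (graph_compl (complete_graph 2)))
     (edge_graph 5 [(0,1),(0,2),(1,2),(0,3),(1,3),(2,3),(0,4),(1,4),(2,4)])"
  by (rule graph_iso_edge_graphI[where f = "case_sum (\<lambda>i. i) (\<lambda>j. 3 + j)"])
    (intro pair_graph_intros, simp_all add: exceptional_simps insert_commute)

lemma graph_iso_K_2_join_co_K_3:
  "graph_iso (graph_join (complete_graph 2) (graph_compl (complete_graph 3)))
     (edge_graph 5 [(0,1),(0,2),(0,3),(0,4),(1,2),(1,3),(1,4)])"
  by (rule graph_iso_edge_graphI[where f = "case_sum (\<lambda>i. i) (\<lambda>j. 2 + j)"])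
    (intro pair_graph_intros, simp_all add: exceptional_simps insert_commute)

lemma graph_iso_K_1_join_K_3_union_K_1:
  "graph_iso (graph_join (complete_graph 1) (disjoint_union (complete_graph 3) (complete_graph 1)))
     (edge_graph 5 [(0,1),(0,2),(0,3),(0,4),(1,2),(1,3),(2,3)])"
  by (rule graph_iso_edge_graphI[where f = "case_sum (\<lambda>i. i) (case_sum (\<lambda>j. 1 + j) (\<lambda>j. 4 + j))"])
    (intro pair_graph_intros, simp_all add: exceptional_simps insert_commute)

lemma graph_iso_K_2_join_K_2_union_K_1:
  "graph_iso (graph_join (complete_graph 2) (disjoint_union (complete_graph 2) (complete_graph 1)))
     (edge_graph 5 [(0,1),(0,2),(0,3),(0,4),(1,2),(1,3),(1,4),(2,3)])"
  by (rule graph_iso_edge_graphI[where f = "case_sum (\<lambda>i. i) (case_sum (\<lambda>j. 2 + j) (\<lambda>j. 4 + j))"])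
    (intro pair_graph_intros, simp_all add: exceptional_simps insert_commute)

text \<open>The complete graph on five vertices equals its edge-list form; the other six graphs are
  exchanged for theirs by \<open>graph_iso_cong_right\<close>.\<close>

lemma exceptional_iff:
  assumes "pair_graph G"
  shows "(\<exists>fs \<in> set exceptional_edges. graph_iso G (edge_graph 5 fs)) \<longleftrightarrow>
      graph_iso G (complete_graph 5)
    \<or> graph_iso G (complete_bipartite_graph 1 4)
    \<or> graph_iso G (complete_bipartite_graph 2 3)
    \<or> graph_iso G (graph_join (complete_graph 3) (graph_compl (complete_graph 2)))
    \<or> graph_iso G (graph_join (complete_graph 2) (graph_compl (complete_graph 3)))
    \<or> graph_iso G (graph_join (complete_graph 1) (disjoint_union (complete_graph 3) (complete_graph 1)))
    \<or> graph_iso G (graph_join (complete_graph 2) (disjoint_union (complete_graph 2) (complete_graph 1)))"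
  unfolding complete_graph_eq_edge_graph[of 5]
    graph_iso_cong_right[OF assms _ pair_graph_edge_graph graph_iso_K_1_4, OF pair_graph_complete_bipartite_graph]
    graph_iso_cong_right[OF assms _ pair_graph_edge_graph graph_iso_K_2_3, OF pair_graph_complete_bipartite_graph]
    graph_iso_cong_right[OF assms _ pair_graph_edge_graph graph_iso_K_3_join_co_K_2,
      OF pair_graph_graph_join[OF pair_graph_complete_graph pair_graph_graph_compl[OF pair_graph_complete_graph]]]
    graph_iso_cong_right[OF assms _ pair_graph_edge_graph graph_iso_K_2_join_co_K_3,
      OF pair_graph_graph_join[OF pair_graph_complete_graph pair_graph_graph_compl[OF pair_graph_complete_graph]]]
    graph_iso_cong_right[OF assms _ pair_graph_edge_graph graph_iso_K_1_join_K_3_union_K_1,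
      OF pair_graph_graph_join[OF pair_graph_complete_graph
        pair_graph_disjoint_union[OF pair_graph_complete_graph pair_graph_complete_graph]]]
    graph_iso_cong_right[OF assms _ pair_graph_edge_graph graph_iso_K_2_join_K_2_union_K_1,
      OF pair_graph_graph_join[OF pair_graph_complete_graph
        pair_graph_disjoint_union[OF pair_graph_complete_graph pair_graph_complete_graph]]]
    exceptional_edges_def
  by simp

section \<open>From edge lists back to arbitrary graphs\<close>

lemma adj_dim_order_five:
  assumes G: "pair_graph G" and n: "card (pverts G) = 5"
  shows "adj_dim G = 2 \<longleftrightarrow>
    (\<forall>X \<in> {G, graph_compl G}. \<not> (\<exists>fs \<in> set exceptional_edges. graph_iso X (edge_graph 5 fs)))"
proof
  assume dim: "adj_dim G = 2"
  have "\<not> graph_iso X (edge_graph 5 fs)" if "X \<in> {G, graph_compl G}" "fs \<in> set exceptional_edges" for X fs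
  proof
    assume "graph_iso X (edge_graph 5 fs)"
    moreover have "pair_graph X" "adj_dim X = 2"
      using that(1) G dim by (auto simp: adj_dim_graph_compl pair_graph_graph_compl)
    ultimately have "dim_two 5 fs"
      unfolding dim_two_iff using adj_dim_graph_iso[OF _ pair_graph_edge_graph] by metis
    then show False using exceptional_not_dim_two that(2) by blast
  qed
  then show "\<forall>X \<in> {G, graph_compl G}. \<not> (\<exists>fs \<in> set exceptional_edges. graph_iso X (edge_graph 5 fs))"
    by blast
next
  assume none: "\<forall>X \<in> {G, graph_compl G}. \<not> (\<exists>fs \<in> set exceptional_edges. graph_iso X (edge_graph 5 fs))"
  obtain es where es: "es \<in> set (subseqs (vertex_pairs 5))" "graph_iso G (edge_graph 5 es)"
    using ex_graph_iso_edge_graph[OF G n] by blast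
  \<comment> \<open>The vertex numbering that carries \<open>G\<close> to \<open>es\<close> also
    carries the complement to \<open>edge_compl 5 es\<close>, so a search on that list speaks about
    \<open>graph_compl G\<close>.\<close>
  have co: "graph_iso (graph_compl G) (edge_graph 5 (edge_compl 5 es))"
    using graph_iso_graph_compl[OF G pair_graph_edge_graph es(2)] by (simp add: graph_compl_edge_graph)
  have "graph_iso G (edge_graph 5 fs)" if "extends_to_iso 5 5 es fs []" for fs
    using graph_iso_trans[OF G pair_graph_edge_graph pair_graph_edge_graph es(2)]
      graph_iso_if_extends_to_iso[OF that] by simp
  moreover have "graph_iso (graph_compl G) (edge_graph 5 fs)"
    if "extends_to_iso 5 5 (edge_compl 5 es) fs []" for fs
    using graph_iso_trans[OF pair_graph_graph_compl[OF G] pair_graph_edge_graph pair_graph_edge_graph co]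
      graph_iso_if_extends_to_iso[OF that] by simp
  ultimately have "dim_two 5 es" using none resolving_pair_or_exceptional[OF es(1)] by blast
  then show "adj_dim G = 2"
    using adj_dim_graph_iso[OF G pair_graph_edge_graph es(2)] by (simp add: dim_two_iff)
qed

text \<open>\<open>P\<close> lets one statement serve two orders: \<open>True\<close> for order
  three, where the complete and edgeless graphs have dimension two, and \<open>False\<close> for
  order four, where exactly they do not.\<close>

lemma adj_dim_complete_or_empty:
  assumes G: "pair_graph G" and n: "card (pverts G) = n"
    and P: "\<forall>es \<in> set (subseqs (vertex_pairs n)).
      dim_two n es \<longleftrightarrow> (P \<longleftrightarrow> es = vertex_pairs n \<or> es = [])"
  shows "adj_dim G = 2 \<longleftrightarrow>
    (P \<longleftrightarrow> graph_iso G (complete_graph n) \<or> graph_iso G (graph_compl (complete_graph n)))"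
proof -
  have dim: "adj_dim G = 2 \<longleftrightarrow> (P \<longleftrightarrow> es = vertex_pairs n \<or> es = [])"
    if "graph_iso G (edge_graph n es)" "es \<in> set (subseqs (vertex_pairs n))" for es
    using P that adj_dim_graph_iso[OF G pair_graph_edge_graph that(1)] by (simp add: dim_two_iff)
  have sub: "vertex_pairs n \<in> set (subseqs (vertex_pairs n))" "[] \<in> set (subseqs (vertex_pairs n))"
    by (rule subseqs_refl Nil_in_set_subseqs)+
  obtain es where "es \<in> set (subseqs (vertex_pairs n))" "graph_iso G (edge_graph n es)"
    using ex_graph_iso_edge_graph[OF G n] by blast
  then show ?thesis
    unfolding graph_compl_complete_graph unfolding complete_graph_eq_edge_graph
    \<comment> \<open>If \<open>G\<close> is complete or edgeless, \<open>dim\<close> is applied to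
      the full or the empty list; otherwise \<open>es\<close> is neither of them and
      \<open>dim\<close> is applied to \<open>es\<close>.\<close>
    using dim[OF _ sub(1)] dim[OF _ sub(2)] dim[of es] by blast
qed


theorem mainTheorem6:
  fixes G :: "'a pair_pre_digraph" and n :: nat
  assumes "pair_graph G" and "card (pverts G) = n" and "n \<ge> 1"
  shows "adj_dim G = 2 \<longleftrightarrow>
      (n = 3 \<and> (graph_iso G (complete_graph 3) \<or> graph_iso G (graph_compl (complete_graph 3))))
    \<or> (n = 4 \<and> \<not> graph_iso G (complete_graph 4) \<and> \<not> graph_iso G (graph_compl (complete_graph 4)))
    \<or> (n = 5 \<and> (\<forall>X \<in> {G, graph_compl G}.
          \<not> graph_iso X (complete_graph 5)
        \<and> \<not> graph_iso X (complete_bipartite_graph 1 4)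
        \<and> \<not> graph_iso X (complete_bipartite_graph 2 3)
        \<and> \<not> graph_iso X (graph_join (complete_graph 3) (graph_compl (complete_graph 2)))
        \<and> \<not> graph_iso X (graph_join (complete_graph 2) (graph_compl (complete_graph 3)))
        \<and> \<not> graph_iso X (graph_join (complete_graph 1)
              (disjoint_union (complete_graph 3) (complete_graph 1)))
        \<and> \<not> graph_iso X (graph_join (complete_graph 2)
              (disjoint_union (complete_graph 2) (complete_graph 1)))))
    \<or> (n = 6 \<and> (\<exists>(a::nat) b c d e f H K.
          distinct [a, b, c, d, e, f]
        \<and> pair_graph H \<and> pverts H = {a, b}
        \<and> pair_graph K \<and> pverts K = {c, d, e, f}
        \<and> graph_iso G (six_vertex_graph a b c d e f H K)))"
proof -
  note G = assms(1) and n = assms(2)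
  note fin = pair_graphD(1)[OF G]
  consider "n = 1" | "n = 2" | "n = 3" | "n = 4" | "n = 5" | "n = 6" | "6 < n"
    using assms(3) by linarith
  then show ?thesis
  proof cases
    case 1
    obtain es where "es \<in> set (subseqs (vertex_pairs 1))" "graph_iso G (edge_graph 1 es)"
      using ex_graph_iso_edge_graph[OF G n[unfolded 1]] by blast
    then have "adj_dim G \<noteq> 2"
      using not_dim_two_order_one adj_dim_graph_iso[OF G pair_graph_edge_graph]
      unfolding dim_two_iff by metis
    then show ?thesis using 1 by simp
  next
    case 2
    obtain es where "es \<in> set (subseqs (vertex_pairs 2))" "graph_iso G (edge_graph 2 es)"
      using ex_graph_iso_edge_graph[OF G n[unfolded 2]] by blast
    then have "adj_dim G \<noteq> 2"
      using not_dim_two_order_two adj_dim_graph_iso[OF G pair_graph_edge_graph]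
      unfolding dim_two_iff by metis
    then show ?thesis using 2 by simp
  next
    case 3
    show ?thesis
      using adj_dim_complete_or_empty[OF G n[unfolded 3], of True] dim_two_order_three 3 by simp
  next
    case 4
    show ?thesis
      using adj_dim_complete_or_empty[OF G n[unfolded 4], of False] dim_two_order_four 4 by simp
  next
    case 5
    show ?thesis
      \<comment> \<open>\<open>ball_simps\<close> splits the quantifier over
        \<open>{G, graph_compl G}\<close> into two conjuncts, since each instance of
        \<open>exceptional_iff\<close> rewrites for one fixed graph.\<close>
      unfolding adj_dim_order_five[OF G n[unfolded 5]] ball_simps(7,5) exceptional_iff[OF G]
        exceptional_iff[OF pair_graph_graph_compl[OF G]] using 5 by simp
  next
    case 6
    have "adj_dim G = 2" if "distinct [a, b, c, d, e, f]" "pair_graph H" "pverts H = {a, b}"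
      "pair_graph K" "pverts K = {c, d, e, f}" "graph_iso G (six_vertex_graph a b c d e f H K)"
      for a b c d e f :: nat and H K
      using adj_dim_graph_iso[OF G pair_graph_six_vertex_graph[OF that(1-5)] that(6)]
        adj_dim_six_vertex_graph[OF that(1-5)] by simp
    then have "adj_dim G = 2 \<longleftrightarrow> (\<exists>(a::nat) b c d e f H K. distinct [a, b, c, d, e, f]
        \<and> pair_graph H \<and> pverts H = {a, b} \<and> pair_graph K \<and> pverts K = {c, d, e, f}
        \<and> graph_iso G (six_vertex_graph a b c d e f H K))"
      using graph_iso_six_vertex_graph_if_adj_dim_two[OF G n[unfolded 6]] by blast
    then show ?thesis using 6 by simp
  next
    case 7
    have "adj_dim G \<noteq> 2"
    proof
      assume "adj_dim G = 2"
      then obtain W where "adj_resolving G W" "card W = 2"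
        using adj_dim_eq_two_iff[OF fin] by blast
      then show False using card_pverts_le_if_adj_resolving[OF fin] n 7 by fastforce
    qed
    then show ?thesis using 7 by simp
  qed
qed

end
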